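(* Let $G = T\times H$, where $T$ is a finite $2$-group and $H$ is a finite group of odd order. Then \[ \mathsf{GEN}(G)=\begin{cases} *1, & \text{if } |G| \text{ is odd and } d(G)\ge 3,\\ *1, & \text{if } G\cong \mathbb{Z}_{4k} \text{ for some integer } k\ge 1,\\ *1, & \text{if } G\cong \mathbb{Z}_2^2\times H \text{ with } d(H)\le 2,\\ *2, & \text{if } G\cong \mathbb{Z}_2,\\ *2, & \text{if } |G| \text{ is odd and } d(G)\in\{1,2\},\\ *4, & \text{if } G\cong \mathbb{Z}_{4k+2} \text{ for some integer } k\ge 1,\\ *0, & \text{otherwise.} \end{cases} \]
   Context: For a finite group $G$, $\mathsf{GEN}(G)$ is the following impartial two-player game. A position is a set of elements selected so far; the starting position is $\emptyset$. From a position $P$ with $\langle P\rangle\neq G$, the player to move selects some $g\in G\setminus P$, producing the position $P\cup\{g\}$ (these are the options of $P$); a position $P$ with $\langle P\rangle = G$ has no options. The player who makes the selected set generate $G$ wins (equivalently, the player unable to move loses). The nim-number of a position is defined recursively by $\operatorname{nim}(P)=\operatorname{mex}\{\operatorname{nim}(Q): Q \text{ an option of } P\}$, where $\operatorname{mex}(A)$ is the least nonnegative integer not in $A$ (so positions with no options have nim-number $0$). We write $\mathsf{GEN}(G)=*n$ if $\operatorname{nim}(\emptyset)=n$. $d(G)$ denotes the minimum size of a generating set of $G$ (with $d(G)=0$ for trivial $G$). $\mathbb{Z}_n$ is the cyclic group of order $n$. *)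

theory Defs
  imports "HOL-Algebra.Algebra"
begin

definition mex :: "nat set \<Rightarrow> nat" where
  "mex A = (LEAST n. n \<notin> A)"

function gen_nim :: "('a, 'b) monoid_scheme \<Rightarrow> 'a set \<Rightarrow> nat" where
  "gen_nim G P =
     (if \<not> finite (carrier G) \<or> generate G P = carrier G then 0
      else mex ((\<lambda>g. gen_nim G (insert g P)) ` (carrier G - P)))"
  by auto
termination
proof (relation "measure (\<lambda>(G, P). card (carrier G - P))")
  show "wf (measure (\<lambda>(G, P). card (carrier G - P)))" by simp
next
  fix G :: "('a, 'b) monoid_scheme" and P g
  assume a: "\<not> (\<not> finite (carrier G) \<or> generate G P = carrier G)"
     and g: "g \<in> carrier G - P"
  then have "carrier G - insert g P \<subset> carrier G - P" by auto
  with a show "((G, insert g P), G, P) \<in> measure (\<lambda>(G, P). card (carrier G - P))"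
    by (auto intro: psubset_card_mono)
qed

definition GEN_nim :: "('a, 'b) monoid_scheme \<Rightarrow> nat" where
  "GEN_nim G = gen_nim G {}"

definition min_gens :: "('a, 'b) monoid_scheme \<Rightarrow> nat" where
  "min_gens G = (LEAST n. \<exists>S. S \<subseteq> carrier G \<and> finite S \<and> card S = n
                              \<and> generate G S = carrier G)"

end

theory Submission
  imports Defs
begin

text \<open>
  Write \<open>d(P)\<close> for the least number of elements that extend a position \<open>P\<close> to a generating set. A move
  lowers \<open>d\<close> by at most one, a lowering move always exists, and a move keeping \<open>\<langle>P\<rangle>\<close> exists unless
  \<open>P = \<langle>P\<rangle>\<close>. Hence, as long as the parity of \<open>|\<langle>P\<rangle>|\<close> cannot change any more, the nim-number of \<open>P\<close>
  depends only on \<open>d(P)\<close> and on whether \<open>|P|\<close> and \<open>|\<langle>P\<rangle>|\<close> have the same parity. This settles groups of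
  odd order and, in \<open>T \<times> H\<close>, all positions outside \<open>1 \<times> H\<close>.

  For a position \<open>1 \<times> Q\<close>, coprimality gives \<open>d(1 \<times> Q \<union> {(t, h)}) = max (d({t})) (d(Q \<union> {h}))\<close>, so
  the nim-number depends only on \<open>d(Q)\<close>, the parity of \<open>|Q|\<close> and the set of values \<open>d({t})\<close> for
  \<open>t \<noteq> 1\<close>. That set is \<open>{0}\<close> for \<open>T = \<int>\<^sub>2\<close>, \<open>{0, 1}\<close> for larger cyclic \<open>T\<close>, \<open>{1}\<close> for
  \<open>T = \<int>\<^sub>2\<^sup>2\<close>, \<open>{1, 2}\<close> for the other \<open>T\<close> of rank two, and contains only numbers \<open>\<ge> 2\<close> for higher rank.
\<close>

section \<open>The game\<close>

declare gen_nim.simps [simp del]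

lemma mex_eqI:
  assumes "n \<notin> A" and "\<And>m. m < n \<Longrightarrow> m \<in> A"
  shows "mex A = n"
  unfolding mex_def using assms by (intro Least_equality) (auto intro: leI)

text \<open>Nim-numbers are guessed as a formula \<open>f\<close> and then verified with this rule:
  \<open>avoid\<close> and \<open>reach\<close> make \<open>f P\<close> the mex over the options of
  \<open>P\<close>, and induction on the number of unselected elements identifies \<open>f\<close>
  with \<open>gen_nim\<close>.\<close>

lemma gen_nim_eqI:
  fixes G :: "('a, 'b) monoid_scheme"
  assumes fin: "finite (carrier G)"
    and gen: "\<And>P. P \<subseteq> carrier G \<Longrightarrow> generate G P = carrier G \<Longrightarrow> f P = 0"
    and avoid: "\<And>P g. P \<subseteq> carrier G \<Longrightarrow> generate G P \<noteq> carrier G \<Longrightarrow> g \<in> carrier G - P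
                  \<Longrightarrow> f (insert g P) \<noteq> f P"
    and reach: "\<And>P m. P \<subseteq> carrier G \<Longrightarrow> generate G P \<noteq> carrier G \<Longrightarrow> m < f P
                  \<Longrightarrow> \<exists>g \<in> carrier G - P. f (insert g P) = m"
    and "P \<subseteq> carrier G"
  shows "gen_nim G P = f P"
  using \<open>P \<subseteq> carrier G\<close>
proof (induction "card (carrier G - P)" arbitrary: P rule: less_induct)
  case less
  show ?case
  proof (cases "generate G P = carrier G")
    case True
    then show ?thesis using less.prems gen by (simp add: gen_nim.simps[of G P])
  next
    case False
    have IH: "gen_nim G (insert g P) = f (insert g P)" if "g \<in> carrier G - P" for g
    proof -
      have "carrier G - insert g P \<subset> carrier G - P" using that by auto
      then have "card (carrier G - insert g P) < card (carrier G - P)"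
        using fin by (intro psubset_card_mono) auto
      then show ?thesis using less that by auto
    qed
    have "mex ((\<lambda>g. gen_nim G (insert g P)) ` (carrier G - P)) = f P"
    proof (rule mex_eqI)
      show "f P \<notin> (\<lambda>g. gen_nim G (insert g P)) ` (carrier G - P)"
        using avoid[OF less.prems False] IH by fastforce
      show "m \<in> (\<lambda>g. gen_nim G (insert g P)) ` (carrier G - P)" if "m < f P" for m
        using reach[OF less.prems False that] IH by force
    qed
    then show ?thesis using False fin by (simp add: gen_nim.simps[of G P])
  qed
qed

section \<open>The number of generators that a position lacks\<close>

definition gens_needed :: "('a, 'b) monoid_scheme \<Rightarrow> 'a set \<Rightarrow> nat" where
  "gens_needed G P = (LEAST n. \<exists>S. S \<subseteq> carrier G \<and> finite S \<and> card S = n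
                                \<and> generate G (P \<union> S) = carrier G)"

lemma min_gens_eq_gens_needed: "min_gens G = gens_needed G {}"
  by (simp add: min_gens_def gens_needed_def)

locale finite_group = group +
  assumes finite_carrier: "finite (carrier G)"
begin

text \<open>Trades \<open>LEAST\<close> for plain existence. The minimum is attained because
  \<open>S = carrier G\<close> is always admissible.\<close>

lemma gens_needed_le_iff:
  assumes P: "P \<subseteq> carrier G"
  shows "gens_needed G P \<le> n \<longleftrightarrow>
    (\<exists>S. S \<subseteq> carrier G \<and> card S \<le> n \<and> generate G (P \<union> S) = carrier G)"
proof
  have "generate G (P \<union> carrier G) = carrier G"
    using P generate_incl[of "carrier G"] generate.incl[of _ "carrier G" G] by (auto simp: Un_absorb1)
  then have "\<exists>n S. S \<subseteq> carrier G \<and> finite S \<and> card S = n \<and> generate G (P \<union> S) = carrier G"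
    using finite_carrier by blast
  from LeastI_ex[OF this] obtain S where "S \<subseteq> carrier G" "card S = gens_needed G P"
    "generate G (P \<union> S) = carrier G"
    unfolding gens_needed_def by blast
  then show "\<exists>S. S \<subseteq> carrier G \<and> card S \<le> n \<and> generate G (P \<union> S) = carrier G"
    if "gens_needed G P \<le> n"
    using that by (intro exI[of _ S]) auto
next
  assume "\<exists>S. S \<subseteq> carrier G \<and> card S \<le> n \<and> generate G (P \<union> S) = carrier G"
  then obtain S where S: "S \<subseteq> carrier G" "card S \<le> n" "generate G (P \<union> S) = carrier G" by blast
  have "gens_needed G P \<le> card S"
    unfolding gens_needed_def using S finite_carrier
    by (intro Least_le exI[of _ S]) (auto intro: finite_subset)
  with S show "gens_needed G P \<le> n" by simp
qed

lemma gens_needed_eq_0_iff: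
  assumes "P \<subseteq> carrier G"
  shows "gens_needed G P = 0 \<longleftrightarrow> generate G P = carrier G"
proof -
  have "S = {}" if "S \<subseteq> carrier G" "card S \<le> 0" for S
    using that finite_carrier by (auto dest: finite_subset)
  then have "(\<exists>S. S \<subseteq> carrier G \<and> card S \<le> 0 \<and> generate G (P \<union> S) = carrier G)
      \<longleftrightarrow> generate G (P \<union> {}) = carrier G"
    by (metis card.empty empty_subsetI order_refl)
  then show ?thesis
    using gens_needed_le_iff[OF assms, of 0] by simp
qed

lemma generate_eq_carrier_mono:
  assumes "P \<subseteq> Q" "Q \<subseteq> carrier G" "generate G P = carrier G"
  shows "generate G Q = carrier G"
  using assms mono_generate[of P Q] generate_incl[of Q] by auto

text \<open>A recursion that peels one element off the completing set. Since \<open>g\<close> may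
  already lie in \<open>P\<close>, wasted elements are allowed; this is what later permits an
  independent choice in the two factors of a product.\<close>

lemma gens_needed_le_Suc_iff:
  assumes P: "P \<subseteq> carrier G"
  shows "gens_needed G P \<le> Suc n \<longleftrightarrow> (\<exists>g \<in> carrier G. gens_needed G (insert g P) \<le> n)"
proof
  assume "gens_needed G P \<le> Suc n"
  then obtain S where S: "S \<subseteq> carrier G" "card S \<le> Suc n" "generate G (P \<union> S) = carrier G"
    using gens_needed_le_iff[OF P] by blast
  have finS: "finite S" using S finite_carrier by (auto intro: finite_subset)
  obtain g S' where g: "g \<in> carrier G" "S' \<subseteq> carrier G" "card S' \<le> n" "P \<union> S \<subseteq> insert g P \<union> S'"
  proof (cases "S = {}")
    case True
    \<comment> \<open>Nothing needs to be added here, so the identity serves as a dummy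
      element.\<close>
    then show ?thesis by (intro that[of "\<one>" "{}"]) auto
  next
    case False
    then obtain g where "g \<in> S" by blast
    then show ?thesis using S finS by (intro that[of g "S - {g}"]) auto
  qed
  have "generate G (insert g P \<union> S') = carrier G"
    by (rule generate_eq_carrier_mono[OF g(4) _ S(3)]) (use P g in auto)
  then show "\<exists>g \<in> carrier G. gens_needed G (insert g P) \<le> n"
    using g P gens_needed_le_iff[of "insert g P" n] by auto
next
  assume "\<exists>g \<in> carrier G. gens_needed G (insert g P) \<le> n"
  then obtain g where g: "g \<in> carrier G" "gens_needed G (insert g P) \<le> n" by blast
  then obtain S where S: "S \<subseteq> carrier G" "card S \<le> n" "generate G (insert g P \<union> S) = carrier G"
    using gens_needed_le_iff[of "insert g P" n] P by auto
  have "card (insert g S) \<le> Suc n"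
    using S(2) card_insert_le_m1[of "Suc n" S g] by simp
  then show "gens_needed G P \<le> Suc n"
    using S g gens_needed_le_iff[OF P] by (intro iffD2[OF gens_needed_le_iff[OF P]] exI[of _ "insert g S"]) auto
qed

lemma gens_needed_mono:
  assumes "P \<subseteq> Q" "Q \<subseteq> carrier G"
  shows "gens_needed G Q \<le> gens_needed G P"
proof -
  have P: "P \<subseteq> carrier G" using assms by auto
  obtain S where S: "S \<subseteq> carrier G" "card S \<le> gens_needed G P" "generate G (P \<union> S) = carrier G"
    using gens_needed_le_iff[OF P, of "gens_needed G P"] by auto
  have "generate G (Q \<union> S) = carrier G"
    by (rule generate_eq_carrier_mono[OF _ _ S(3)]) (use assms S(1) in auto)
  then show ?thesis using S gens_needed_le_iff[OF assms(2)] by blast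
qed

lemma gens_needed_insert_cases:
  assumes "P \<subseteq> carrier G" "g \<in> carrier G"
  shows "gens_needed G (insert g P) \<in> {gens_needed G P, gens_needed G P - 1}"
proof -
  have "gens_needed G (insert g P) \<le> gens_needed G P"
    using assms by (intro gens_needed_mono) auto
  moreover have "gens_needed G P \<le> Suc (gens_needed G (insert g P))"
    using assms gens_needed_le_Suc_iff by blast
  ultimately show ?thesis by auto
qed

lemma gens_needed_decrease:
  assumes "P \<subseteq> carrier G" "gens_needed G P > 0"
  obtains g where "g \<in> carrier G - P" "gens_needed G (insert g P) = gens_needed G P - 1"
proof -
  have "gens_needed G P \<le> Suc (gens_needed G P - 1)" by simp
  then obtain g where g: "g \<in> carrier G" "gens_needed G (insert g P) \<le> gens_needed G P - 1"
    using gens_needed_le_Suc_iff[OF assms(1)] by blast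
  moreover have "g \<notin> P"
    using g assms(2) by (auto simp: insert_absorb)
  ultimately show ?thesis
    using that[of g] gens_needed_insert_cases[OF assms(1), of g] by force
qed

lemma gens_needed_insert_generate:
  assumes P: "P \<subseteq> carrier G" and g: "g \<in> generate G P"
  shows "gens_needed G (insert g P) = gens_needed G P"
proof (rule antisym)
  have gc: "g \<in> carrier G" using assms generate_in_carrier by blast
  show "gens_needed G (insert g P) \<le> gens_needed G P"
    using P gc by (intro gens_needed_mono) auto
  obtain S where S: "S \<subseteq> carrier G" "card S \<le> gens_needed G (insert g P)"
    "generate G (insert g P \<union> S) = carrier G"
    using gens_needed_le_iff[of "insert g P" "gens_needed G (insert g P)"] P gc by auto
  have PS: "P \<union> S \<subseteq> carrier G" using P S by auto
  have "insert g P \<union> S \<subseteq> generate G (P \<union> S)"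
    using g mono_generate[of P "P \<union> S"] by (auto intro: generate.incl)
  then have "generate G (insert g P \<union> S) \<subseteq> generate G (P \<union> S)"
    by (rule generate_subgroup_incl[OF _ generate_is_subgroup[OF PS]])
  then have "generate G (P \<union> S) = carrier G"
    using S generate_incl[OF PS] by auto
  then show "gens_needed G P \<le> gens_needed G (insert g P)"
    using S gens_needed_le_iff[OF P] by blast
qed

lemma gens_needed_insert_one:
  assumes "P \<subseteq> carrier G"
  shows "gens_needed G (insert \<one> P) = gens_needed G P"
  using assms generate.one by (rule gens_needed_insert_generate)

lemma ex_generate_diff:
  assumes "P \<subseteq> carrier G" "\<not> subgroup P G"
  obtains g where "g \<in> generate G P - P"
proof -
  have "generate G P \<noteq> P" using assms generate_is_subgroup[of P] by metis
  then show ?thesis using that generate.incl[of _ P G] by blast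
qed

lemma finite_subset_carrier: "P \<subseteq> carrier G \<Longrightarrow> finite P"
  using finite_carrier finite_subset by blast

end

text \<open>A position that fills the subgroup it generates has no option generating the same subgroup.
  The flag \<open>b\<close> records whether the size of the position has the parity of that subgroup's order.\<close>

definition nim_by_rank :: "nat \<Rightarrow> bool \<Rightarrow> nat" where
  "nim_by_rank d b =
     (if d = 0 then 0
      else if d = 1 then (if b then 1 else 2)
      else if d = 2 then (if b then 0 else 2)
      else if b then 0 else 1)"

section \<open>Positions whose subgroup parity is fixed, and groups of odd order\<close>

lemma nim_by_rank_avoid:
  assumes "d > 0" and "d' \<in> {d, d - 1}"
  shows "nim_by_rank d' (\<not> b) \<noteq> nim_by_rank d b"
  using assms by (auto simp: nim_by_rank_def)

text \<open>A move of equal rank is required only for \<open>\<not> b\<close>. If \<open>b\<close>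
  holds, the position may fill its subgroup, and then no move staying inside that subgroup
  exists.\<close>

lemma nim_by_rank_reach:
  assumes "m < nim_by_rank d b"
  shows "nim_by_rank (d - 1) (\<not> b) = m \<or> \<not> b \<and> nim_by_rank d True = m"
  using assms by (auto simp: nim_by_rank_def split: if_splits)

text \<open>All subgroups have odd order, so the flag of \<open>nim_by_rank\<close> is
  \<open>odd (card P)\<close>, and it flips with every move.\<close>

theorem (in finite_group) GEN_nim_odd_order:
  assumes odd: "odd (order G)"
  shows "GEN_nim G = nim_by_rank (min_gens G) False"
proof -
  let ?f = "\<lambda>P. nim_by_rank (gens_needed G P) (odd (card P))"
  have "gen_nim G {} = ?f {}"
  proof (rule gen_nim_eqI[OF finite_carrier])
    fix P assume P: "P \<subseteq> carrier G"
    note finP = finite_subset_carrier[OF P]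
    show "?f P = 0" if "generate G P = carrier G"
      using that gens_needed_eq_0_iff[OF P] by (simp add: nim_by_rank_def)
    assume ng: "generate G P \<noteq> carrier G"
    then have pos: "gens_needed G P > 0" using gens_needed_eq_0_iff[OF P] by simp
    show "?f (insert g P) \<noteq> ?f P" if "g \<in> carrier G - P" for g
      using that finP nim_by_rank_avoid[OF pos gens_needed_insert_cases[OF P], of g "odd (card P)"] by simp
    show "\<exists>g \<in> carrier G - P. ?f (insert g P) = m" if "m < ?f P" for m
      using nim_by_rank_reach[OF that]
    proof
      assume m: "nim_by_rank (gens_needed G P - 1) (\<not> odd (card P)) = m"
      obtain g where "g \<in> carrier G - P" "gens_needed G (insert g P) = gens_needed G P - 1"
        using gens_needed_decrease[OF P pos] .
      then show ?thesis using m finP by (intro bexI[of _ g]) auto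
    next
      assume m: "\<not> odd (card P) \<and> nim_by_rank (gens_needed G P) True = m"
      \<comment> \<open>By Lagrange a set of even size is no subgroup here, so a move inside the
        generated subgroup remains.\<close>
      have "\<not> subgroup P G"
        using m odd lagrange[of P] by (metis dvd_mult)
      then obtain g where g: "g \<in> generate G P - P" using ex_generate_diff[OF P] by blast
      then have "g \<in> carrier G - P" using generate_in_carrier[OF P] by blast
      then show ?thesis
        using g m finP gens_needed_insert_generate[OF P, of g] by (intro bexI[of _ g]) auto
    qed
  qed auto
  then show ?thesis by (simp add: GEN_nim_def min_gens_eq_gens_needed)
qed

section \<open>Finite groups and finite 2-groups\<close>

context finite_group
begin

section \<open>Groups generated by one element\<close>

lemma generate_singleton_eq_carrier_iff:
  assumes "x \<in> carrier G"
  shows "generate G {x} = carrier G \<longleftrightarrow> ord x = order G"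
proof -
  have "generate G {x} \<subseteq> carrier G" using assms by (intro generate_incl) simp
  from card_subset_eq[OF finite_carrier this] show ?thesis
    using generate_pow_card[OF assms] by (auto simp: order_def)
qed

lemma min_gens_le_1_iff: "min_gens G \<le> 1 \<longleftrightarrow> (\<exists>x \<in> carrier G. ord x = order G)"
  using gens_needed_le_Suc_iff[of "{}" 0] gens_needed_eq_0_iff generate_singleton_eq_carrier_iff
  by (simp add: min_gens_eq_gens_needed)

lemma min_gens_eq_0_iff: "min_gens G = 0 \<longleftrightarrow> carrier G = {\<one>}"
  using gens_needed_eq_0_iff[of "{}"] by (auto simp: min_gens_eq_gens_needed generate_empty)

lemma min_gens_eq_0_iff_order: "min_gens G = 0 \<longleftrightarrow> order G = 1"
  using min_gens_eq_0_iff one_closed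
  by (metis One_nat_def card_1_singletonE is_singletonI is_singleton_altdef order_def singletonD)

lemma pow_2: "x \<in> carrier G \<Longrightarrow> x [^] (2::nat) = x \<otimes> x"
  by (simp add: numeral_2_eq_2)

lemma pow_mod_ord:
  assumes "x \<in> carrier G"
  shows "x [^] (m mod ord x) = x [^] (m::nat)"
proof -
  have "x [^] m = x [^] (m mod ord x + ord x * (m div ord x))" by simp
  also have "\<dots> = x [^] (m mod ord x) \<otimes> (x [^] ord x) [^] (m div ord x)"
    using assms by (simp only: nat_pow_mult[symmetric] nat_pow_pow)
  finally show ?thesis using assms by simp
qed

lemma carrier_eq_nat_powers:
  assumes "x \<in> carrier G" "ord x = order G" "y \<in> carrier G"
  obtains i where "i < order G" "y = x [^] (i::nat)"
proof -
  have pos: "order G > 0" using finite_carrier by (simp add: order_gt_0_iff_finite)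
  have "generate G {x} = carrier G"
    using assms generate_singleton_eq_carrier_iff by simp
  then obtain k :: int where k: "y = x [^] k"
    using generate_pow[OF assms(1)] assms(3) by blast
  have "x [^] k = x [^] (k mod int (order G))"
    using assms(1,2) by (simp add: int_pow_eq flip: mod_eq_dvd_iff)
  also have "\<dots> = x [^] nat (k mod int (order G))"
    using pos by (simp add: int_pow_def2)
  finally show ?thesis
    using that[of "nat (k mod int (order G))"] k pos by (simp add: nat_less_iff)
qed

text \<open>Turns the isomorphism conditions of the theorem into order and rank. One direction
  transports the generator of the integers mod \<open>k\<close>; the other maps \<open>i\<close> to
  \<open>x [^] i\<close>, which is injective because it is onto a set of the same size.\<close>

lemma iso_integer_mod_group_iff:
  assumes "k > 0"
  shows "G \<cong> integer_mod_group k \<longleftrightarrow> order G = k \<and> min_gens G \<le> 1"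
proof
  interpret Z: group "integer_mod_group k" by simp
  assume "G \<cong> integer_mod_group k"
  then have "integer_mod_group k \<cong> G" by (rule iso_sym)
  then obtain f where f: "f \<in> iso (integer_mod_group k) G" by (auto simp: is_iso_def)
  interpret f: group_hom "integer_mod_group k" G f
    using f by unfold_locales (auto simp: iso_def)
  have bij: "bij_betw f {0..<int k} (carrier G)"
    using f assms by (auto simp: iso_def carrier_integer_mod_group)
  have ord: "order G = k" using bij_betw_same_card[OF bij] by (simp add: order_def)
  \<comment> \<open>Reduction mod \<open>k\<close> matters for \<open>k = 1\<close>, where 1 itself
    is not in the carrier.\<close>
  let ?x = "f (1 mod int k)"
  have x: "?x \<in> carrier G" using bij assms by (auto simp: bij_betw_def)
  have "y \<in> generate G {?x}" if "y \<in> carrier G" for y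
  proof -
    have "y \<in> f ` {0..<int k}" using that bij by (simp add: bij_betw_def)
    then obtain i where i: "i \<in> {0..<int k}" "y = f i" by blast
    have "f ((1 mod int k) [^]\<^bsub>integer_mod_group k\<^esub> nat i) = ?x [^] nat i"
      using assms by (intro f.hom_nat_pow) (auto simp: carrier_integer_mod_group)
    moreover have "(1 mod int k) [^]\<^bsub>integer_mod_group k\<^esub> nat i = i"
      using i by (simp add: mod_mult_right_eq)
    ultimately have "y = ?x [^] int (nat i)" using i by (simp add: int_pow_int)
    then show ?thesis using generate_pow[OF x] by blast
  qed
  then have "generate G {?x} = carrier G" using generate_incl[of "{?x}"] x by blast
  then show "order G = k \<and> min_gens G \<le> 1"
    using ord x min_gens_le_1_iff generate_singleton_eq_carrier_iff by blast
next
  assume k: "order G = k \<and> min_gens G \<le> 1"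
  then obtain x where x: "x \<in> carrier G" "ord x = k" using min_gens_le_1_iff by blast
  let ?f = "\<lambda>i. x [^] nat i"
  have hom: "?f \<in> hom (integer_mod_group k) G"
  proof (rule homI)
    fix i j assume ij: "i \<in> carrier (integer_mod_group k)" "j \<in> carrier (integer_mod_group k)"
    have "x [^] ((nat i + nat j) mod k) = x [^] (nat i + nat j)"
      using pow_mod_ord[OF x(1), of "nat i + nat j"] x(2) by simp
    moreover have "nat ((i + j) mod int k) = (nat i + nat j) mod k"
      using ij assms by (simp add: carrier_integer_mod_group nat_mod_distrib nat_add_distrib)
    ultimately show "?f (i \<otimes>\<^bsub>integer_mod_group k\<^esub> j) = ?f i \<otimes> ?f j"
      using x by (simp add: nat_pow_mult)
  qed (use x in auto)
  have surj: "?f ` {0..<int k} = carrier G"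
  proof
    show "carrier G \<subseteq> ?f ` {0..<int k}"
    proof
      fix y assume "y \<in> carrier G"
      then obtain i where "i < k" "y = x [^] i" using carrier_eq_nat_powers[OF x(1)] x k by metis
      then show "y \<in> ?f ` {0..<int k}" by (intro image_eqI[of _ _ "int i"]) auto
    qed
  qed (use x in auto)
  moreover have "inj_on ?f {0..<int k}"
    using surj k by (intro eq_card_imp_inj_on) (auto simp: order_def)
  ultimately have "?f \<in> iso (integer_mod_group k) G"
    using hom assms by (auto simp: iso_def bij_betw_def carrier_integer_mod_group)
  then show "G \<cong> integer_mod_group k"
    using group.iso_sym[OF group_integer_mod_group] by (auto simp: is_iso_def)
qed

text \<open>Every element is its own inverse, so inverting a product only swaps its factors.\<close>

lemma exponent_2_commute:
  assumes "\<And>x. x \<in> carrier G \<Longrightarrow> x \<otimes> x = \<one>" "x \<in> carrier G" "y \<in> carrier G"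
  shows "x \<otimes> y = y \<otimes> x"
proof -
  have "inv z = z" if "z \<in> carrier G" for z using that assms(1) inv_equality by blast
  then show ?thesis using inv_mult_group[of x y] assms(2,3) by simp
qed

lemma iso_Klein_four:
  assumes four: "order G = 4" and sq: "\<And>x. x \<in> carrier G \<Longrightarrow> x \<otimes> x = \<one>"
  shows "G \<cong> integer_mod_group 2 \<times>\<times> integer_mod_group 2"
proof -
  let ?Z = "integer_mod_group 2"
  interpret comm_group G
    by unfold_locales (simp add: exponent_2_commute sq)
  have "\<exists>a. a \<in> carrier G - {\<one>}"
    using four card_mono[of "{\<one>}" "carrier G"] by (force simp: order_def)
  then obtain a where a: "a \<in> carrier G" "a \<noteq> \<one>" by blast
  have "card {\<one>, a} \<le> 2" by (simp add: card_insert_if)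
  then have "\<not> carrier G \<subseteq> {\<one>, a}"
    using four card_mono[of "{\<one>, a}" "carrier G"] by (auto simp: order_def)
  then obtain b where b: "b \<in> carrier G" "b \<noteq> \<one>" "b \<noteq> a" by blast
  have ab: "a \<otimes> b \<noteq> \<one>" "a \<otimes> b \<noteq> a" "a \<otimes> b \<noteq> b"
    using a b sq[OF a(1)] l_cancel[of a b a] l_cancel[of a b \<one>] r_cancel[of a b \<one>] by auto
  \<comment> \<open>The elements \<open>a\<close> and \<open>b\<close> serve as a basis over the
    field with two elements.\<close>
  let ?f = "\<lambda>(i::int, j::int). a [^] nat i \<otimes> b [^] nat j"
  have Z: "carrier ?Z = {0, 1}" by (auto simp: carrier_integer_mod_group)
  have pow: "x [^] nat ((i + j) mod 2) = x [^] nat i \<otimes> x [^] nat j"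
    if "x \<in> carrier G" "i \<in> {0, 1}" "j \<in> {0, 1}" for x and i j :: int
    using that sq by (auto simp: nat_pow_def)
  have cancel: "x \<otimes> (x \<otimes> y) = y" if "x \<in> carrier G" "y \<in> carrier G" for x y
    using that sq by (simp flip: m_assoc)
  have hom: "?f \<in> hom (?Z \<times>\<times> ?Z) G"
    using a b cancel by (intro homI) (auto simp: Z pow sq m_ac)
  have inj: "inj_on ?f (carrier (?Z \<times>\<times> ?Z))"
    using a b ab by (auto simp: inj_on_def Z nat_pow_def)
  have "?f ` carrier (?Z \<times>\<times> ?Z) = carrier G"
  proof (rule card_subset_eq[OF finite_carrier])
    show "?f ` carrier (?Z \<times>\<times> ?Z) \<subseteq> carrier G" using a b by auto
    show "card (?f ` carrier (?Z \<times>\<times> ?Z)) = card (carrier G)"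
      using card_image[OF inj] four by (simp add: Z order_def card_cartesian_product)
  qed
  with hom inj have "?f \<in> iso (?Z \<times>\<times> ?Z) G" by (auto simp: iso_def bij_betw_def)
  then show ?thesis
    using group.iso_sym[OF DirProd_group[OF group_integer_mod_group group_integer_mod_group]]
    by (auto simp: is_iso_def)
qed

text \<open>Natural exponents suffice, since in a finite group the inverse of \<open>y\<close> is
  \<open>y [^] (ord y - 1)\<close>; commutation collects the powers of \<open>a\<close> on the
  left.\<close>

lemma generate_commuting_pair:
  assumes a: "a \<in> carrier G" and b: "b \<in> carrier G" and ab: "a \<otimes> b = b \<otimes> a"
    and x: "x \<in> generate G {a, b}"
  shows "\<exists>(i::nat) (j::nat). x = a [^] i \<otimes> b [^] j"
  using x
proof (induction rule: generate.induct)
  case one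
  have "\<one> = a [^] (0::nat) \<otimes> b [^] (0::nat)" by simp
  then show ?case by blast
next
  case (incl h)
  have "a = a [^] (1::nat) \<otimes> b [^] (0::nat)" "b = a [^] (0::nat) \<otimes> b [^] (1::nat)"
    using a b by simp_all
  then show ?case using incl by blast
next
  case (inv h)
  have inv: "inv y = y [^] (ord y - 1)" if "y \<in> carrier G" for y
  proof (rule inv_equality)
    have "y [^] (ord y - 1) \<otimes> y = y [^] (Suc (ord y - 1))" by simp
    then show "y [^] (ord y - 1) \<otimes> y = \<one>"
      using ord_ge_1[OF finite_carrier that] that by (simp del: nat_pow_Suc)
  qed (use that in auto)
  have "inv a = a [^] (ord a - 1) \<otimes> b [^] (0::nat)" "inv b = a [^] (0::nat) \<otimes> b [^] (ord b - 1)"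
    using a b inv by simp_all
  then show ?case using inv.hyps by blast
next
  case (eng h1 h2)
  then obtain i j k l :: nat where "h1 = a [^] i \<otimes> b [^] j" "h2 = a [^] k \<otimes> b [^] l" by blast
  moreover have "b [^] j \<otimes> a [^] k = a [^] k \<otimes> b [^] j"
    using group_commutes_pow[of "b" "a [^] k" j] group_commutes_pow[OF ab a b, of k] a b by simp
  then have "b [^] j \<otimes> (a [^] k \<otimes> b [^] l) = a [^] k \<otimes> (b [^] j \<otimes> b [^] l)"
    using a b by (simp flip: m_assoc)
  ultimately have "h1 \<otimes> h2 = (a [^] i \<otimes> a [^] k) \<otimes> (b [^] j \<otimes> b [^] l)"
    using a b by (simp add: m_assoc)
  then have "h1 \<otimes> h2 = a [^] (i + k) \<otimes> b [^] (j + l)"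
    using a b by (simp add: nat_pow_mult)
  then show ?case by blast
qed

end

section \<open>Finite 2-groups\<close>

locale finite_2_group = finite_group +
  fixes n :: nat
  assumes order_eq: "order G = 2 ^ n"
begin

lemma even_ord:
  assumes "x \<in> carrier G" "x \<noteq> \<one>"
  shows "even (ord x)"
proof -
  have "ord x dvd 2 ^ n" using ord_dvd_group_order[OF assms(1)] order_eq by simp
  then obtain k where k: "ord x = 2 ^ k" by (auto simp: divides_primepow_nat)
  then have "k \<noteq> 0" using ord_eq_1[OF assms(1)] assms(2) by auto
  then show ?thesis using k by simp
qed

text \<open>The class equation: the group order is even and the class of the identity has size one,
  so another class has odd size. That size divides a power of two, hence is one, which gives a
  nontrivial central element.\<close>

lemma ex_central_involution:
  assumes "carrier G \<noteq> {\<one>}"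
  obtains z where "z \<in> carrier G" "z \<noteq> \<one>" "z \<otimes> z = \<one>" "\<And>x. x \<in> carrier G \<Longrightarrow> x \<otimes> z = z \<otimes> x"
proof -
  let ?\<phi> = "\<lambda>g. \<lambda>h \<in> carrier G. g \<otimes> h \<otimes> inv g"
  interpret conj: group_action G "carrier G" ?\<phi> by (rule action_by_conjugation)
  let ?O = "orbits G (carrier G) ?\<phi>"
  have one_orbit: "orbit G ?\<phi> \<one> = {\<one>}"
    by (auto simp: orbit_def intro: exI[of _ \<one>])
  then have one_in: "{\<one>} \<in> ?O" by (force simp: orbits_def)
  have finO: "finite ?O"
    using finite_carrier by (simp add: orbits_def)
  have "n \<noteq> 0"
  proof
    assume "n = 0"
    then have "card (carrier G) = 1" using order_eq by (simp add: order_def)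
    then show False using assms one_closed by (metis card_1_singletonE singletonD)
  qed
  then have "even (card (carrier G))" using order_eq by (simp add: order_def)
  also have "card (carrier G) = (\<Sum>orb \<in> ?O. card orb)"
    using conj.disjoint_sum[OF finite_carrier, of "\<lambda>_. 1::nat"] by simp
  also have "\<dots> = 1 + (\<Sum>orb \<in> ?O - {{\<one>}}. card orb)"
    using sum.remove[OF finO one_in, of card] by simp
  finally have "\<not> (\<forall>orb \<in> ?O - {{\<one>}}. even (card orb))"
    using dvd_sum[of "?O - {{\<one>}}" 2 card] by auto
  then obtain z where z: "z \<in> carrier G" "orbit G ?\<phi> z \<noteq> {\<one>}" "odd (card (orbit G ?\<phi> z))"
    by (auto simp: orbits_def)
  have "card (orbit G ?\<phi> z) dvd 2 ^ n"
    unfolding order_eq[symmetric] conj.orbit_stabilizer_theorem[OF z(1), symmetric] by (rule dvd_triv_left)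
  then have "card (orbit G ?\<phi> z) = 1"
    using z(3) by (auto simp: divides_primepow_nat)
  then have orb: "orbit G ?\<phi> z = {z}"
    using conj.orbit_refl[OF z(1)] by (auto simp: card_1_singleton_iff)
  have comm: "x \<otimes> z = z \<otimes> x" if "x \<in> carrier G" for x
  proof -
    have "x \<otimes> z \<otimes> inv x \<in> orbit G ?\<phi> z" using that z by (force simp: orbit_def)
    then have "x \<otimes> z \<otimes> inv x = z" using orb by simp
    then show ?thesis using that z by (metis inv_solve_right m_closed)
  qed
  have z1: "z \<noteq> \<one>" using z(2) one_orbit by auto
  \<comment> \<open>This power has order two and inherits centrality from \<open>z\<close>.\<close>
  let ?w = "z [^] (ord z div 2)"
  have pos: "ord z > 0" using ord_ge_1[OF finite_carrier z(1)] by simp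
  have "ord ?w = 2"
    using even_ord[OF z(1) z1] pos ord_pow[of z "ord z div 2"] z by (auto elim!: evenE)
  then have w: "?w \<noteq> \<one>" "?w [^] (2::nat) = \<one>"
    using z pow_ord_eq_1[of ?w] by (force, simp)
  have "x \<otimes> ?w = ?w \<otimes> x" if "x \<in> carrier G" for x
    using group_commutes_pow[OF comm[OF that, symmetric] z(1) that] by simp
  then show ?thesis
    using that[OF nat_pow_closed[OF z(1)] w(1)] w(2) pow_2[OF nat_pow_closed[OF z(1)]] by metis
qed

text \<open>If every nontrivial element is part of a generating pair, apply this to a central involution
  \<open>z\<close>, with partner \<open>u\<close>: all squares then lie in \<open>\<langle>u\<^sup>2\<rangle>\<close>, so \<open>u\<^sup>2 \<noteq> 1\<close> cannot be part of a
  generating pair.\<close>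

lemma Klein_four_if_pairs_generate:
  assumes pairs: "\<And>t. t \<in> carrier G \<Longrightarrow> t \<noteq> \<one> \<Longrightarrow> \<exists>u \<in> carrier G. generate G {t, u} = carrier G"
    and rank: "min_gens G = 2"
  shows "order G = 4" "\<And>x. x \<in> carrier G \<Longrightarrow> x \<otimes> x = \<one>"
proof -
  have noncyclic: "ord x < order G" if "x \<in> carrier G" for x
    using rank min_gens_le_1_iff that ord_le_group_order[OF finite_carrier that]
    by (metis le_neq_implies_less numeral_le_one_iff semiring_norm(69))
  have "carrier G \<noteq> {\<one>}" using rank min_gens_eq_0_iff by auto
  then obtain z where z: "z \<in> carrier G" "z \<noteq> \<one>" "z \<otimes> z = \<one>"
    and central: "\<And>x. x \<in> carrier G \<Longrightarrow> x \<otimes> z = z \<otimes> x"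
    using ex_central_involution by metis
  obtain u where u: "u \<in> carrier G" "generate G {z, u} = carrier G" using pairs z by blast
  have form: "\<exists>(i::nat) (j::nat). x = z [^] i \<otimes> u [^] j" if "x \<in> carrier G" for x
    using generate_commuting_pair[OF z(1) u(1) central[OF u(1), symmetric]] that u by blast
  have z_pow: "z [^] i \<otimes> z [^] i = \<one>" for i :: nat
    using z pow_mult_distrib[of z z i] by simp
  let ?v = "u \<otimes> u"
  have v: "?v \<in> carrier G" using u by simp
  \<comment> \<open>The factor \<open>z [^] i\<close> is central with trivial square, so it
    disappears when \<open>x\<close> is squared.\<close>
  have square: "\<exists>j::nat. x \<otimes> x = ?v [^] j" if x: "x \<in> carrier G" for x
  proof -
    obtain i j :: nat where ij: "x = z [^] i \<otimes> u [^] j" using form[OF x] by blast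
    have comm: "u [^] j \<otimes> z [^] i = z [^] i \<otimes> u [^] j"
      using group_commutes_pow[OF central[symmetric] z(1), of "u [^] j" i] u by simp
    have "x \<otimes> x = z [^] i \<otimes> (u [^] j \<otimes> z [^] i) \<otimes> u [^] j"
      using ij z u by (simp add: m_assoc)
    also have "\<dots> = (z [^] i \<otimes> z [^] i) \<otimes> (u [^] j \<otimes> u [^] j)"
      using z u by (simp add: comm m_assoc)
    also have "\<dots> = ?v [^] j"
      using u z_pow pow_mult_distrib[of u u j] by simp
    finally show ?thesis by blast
  qed
  have v1: "?v = \<one>"
  proof (rule ccontr)
    assume "?v \<noteq> \<one>"
    then obtain w where w: "w \<in> carrier G" "generate G {?v, w} = carrier G" using pairs v by blast
    have "?v \<otimes> w = w \<otimes> ?v"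
    proof -
      obtain i j :: nat where "w = z [^] i \<otimes> u [^] j" using form[OF w(1)] by blast
      moreover have "u \<otimes> (z [^] i \<otimes> u [^] j) = (z [^] i \<otimes> u [^] j) \<otimes> u"
      proof -
        have "u \<otimes> z [^] i = z [^] i \<otimes> u"
          using group_commutes_pow[OF central[OF u(1), symmetric] z(1) u(1)] by simp
        moreover have "u \<otimes> u [^] j = u [^] j \<otimes> u"
          using group_commutes_pow[of u u j] u by simp
        ultimately show ?thesis using u z by (metis m_assoc nat_pow_closed)
      qed
      ultimately have "u \<otimes> w = w \<otimes> u" by simp
      then show ?thesis using u w by (metis m_assoc)
    qed
    note vw = generate_commuting_pair[OF v w(1) this]
    let ?K = "generate G {?v}"
    have K: "?v [^] (i::nat) \<in> ?K" for i
      by (induction i) (auto intro: generate.one generate.eng generate.incl)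
    \<comment> \<open>As \<open>w\<close> commutes with \<open>?v\<close> and its square is a power
      of \<open>?v\<close>, the subgroup \<open>?K\<close> and one translate cover the group. But
      \<open>?K\<close> has \<open>ord u div 2\<close> elements, so \<open>u\<close> alone would
      generate, against rank two.\<close>
    have "carrier G \<subseteq> ?K \<union> (\<lambda>k. k \<otimes> w) ` ?K"
    proof
      fix x assume "x \<in> carrier G"
      then have "x \<in> generate G {?v, w}" using w by simp
      from vw[OF this] obtain i j :: nat where x: "x = ?v [^] i \<otimes> w [^] j" by blast
      obtain m :: nat where m: "w \<otimes> w = ?v [^] m" using square[OF w(1)] by blast
      have even: "?v [^] i \<otimes> w [^] (2 * q) = ?v [^] (i + m * q)" for q :: nat
      proof -
        have "w [^] (2 * q) = (w \<otimes> w) [^] q"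
          using w by (simp add: pow_2 flip: nat_pow_pow)
        then show ?thesis using m v by (simp add: nat_pow_pow nat_pow_mult)
      qed
      show "x \<in> ?K \<union> (\<lambda>k. k \<otimes> w) ` ?K"
      proof (cases "even j")
        case True
        then obtain q where "j = 2 * q" by blast
        then show ?thesis using x even K by auto
      next
        case False
        then obtain q where "j = Suc (2 * q)" by (auto elim!: oddE)
        then have "x = ?v [^] (i + m * q) \<otimes> w"
          using x even[of q] v w by (simp flip: m_assoc)
        then show ?thesis using K by blast
      qed
    qed
    moreover have finK: "finite ?K" using generate_incl[of "{?v}"] v finite_subset_carrier by simp
    ultimately have "order G \<le> card (?K \<union> (\<lambda>k. k \<otimes> w) ` ?K)"
      unfolding order_def by (intro card_mono) auto
    also have "\<dots> \<le> card ?K + card ?K"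
      using card_Un_le[of ?K] card_image_le[OF finK, of "\<lambda>k. k \<otimes> w"] by (meson add_left_mono order_trans)
    also have "card ?K = ord (u [^] (2::nat))"
      using generate_pow_card[OF v] u by (simp add: pow_2)
    also have "\<dots> = ord u div 2"
    proof (rule ord_pow[OF u(1)])
      have "u \<noteq> \<one>" using \<open>?v \<noteq> \<one>\<close> by auto
      then show "even (ord u)" using even_ord[OF u(1)] by simp
    qed simp
    finally have "order G \<le> ord u" by simp
    then show False using noncyclic[OF u(1)] by simp
  qed
  show sq: "x \<otimes> x = \<one>" if "x \<in> carrier G" for x
    using square[OF that] v1 by auto
  \<comment> \<open>With both \<open>z\<close> and \<open>u\<close> squaring to the identity,
    exponents matter only mod 2. This bounds the order by four; the involution \<open>z\<close>,
    which cannot generate alone, rules out order two.\<close>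
  have "x \<in> {\<one>, z, u, z \<otimes> u}" if x: "x \<in> carrier G" for x
  proof -
    have pow: "y [^] i \<in> {\<one>, y}" if "y \<in> carrier G" "y \<otimes> y = \<one>" for y and i :: nat
      using that by (induction i) auto
    obtain i j :: nat where "x = z [^] i \<otimes> u [^] j" using form[OF x] by blast
    then show ?thesis using pow[OF z(1) z(3), of i] pow[OF u(1) v1, of j] z u by auto
  qed
  then have "order G \<le> card {\<one>, z, u, z \<otimes> u}"
    unfolding order_def by (intro card_mono) auto
  also have "\<dots> \<le> 4" by (simp add: card_insert_if)
  finally have le: "2 ^ n \<le> (2::nat) ^ 2" using order_eq by simp
  have "ord z = 2"
  proof -
    have "ord z dvd 2" using pow_eq_id[OF z(1), of 2] z by (simp add: pow_2)
    moreover have "ord z \<noteq> 1" using z ord_eq_1 by blast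
    ultimately show ?thesis by (metis prime_nat_iff two_is_prime_nat)
  qed
  then have "(2::nat) ^ 1 < 2 ^ n" using noncyclic[OF z(1)] order_eq by simp
  then have "1 < n" by (simp only: power_strict_increasing_iff)
  moreover have "n \<le> 2" using le by (simp only: power_increasing_iff)
  ultimately have "n = 2" by simp
  then show "order G = 4" using order_eq by simp
qed

end

section \<open>Direct products of coprime order\<close>

lemma pow_DirProd: "(t, h) [^]\<^bsub>T \<times>\<times> H\<^esub> (n::nat) = (t [^]\<^bsub>T\<^esub> n, h [^]\<^bsub>H\<^esub> n)"
  by (induction n) (simp_all add: nat_pow_def)

locale coprime_product = T: finite_group T + H: finite_group H
  for T :: "('a, 'c) monoid_scheme" and H :: "('b, 'd) monoid_scheme" +
  assumes coprime_orders: "coprime (order T) (order H)"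
begin

sublocale G: finite_group "T \<times>\<times> H"
  using DirProd_group[OF T.group_axioms H.group_axioms] T.finite_carrier H.finite_carrier
  by (simp add: finite_group_def finite_group_axioms_def)

sublocale fst: group_hom "T \<times>\<times> H" T fst
  by unfold_locales (auto simp: hom_def)

sublocale snd: group_hom "T \<times>\<times> H" H snd
  by unfold_locales (auto simp: hom_def)

text \<open>By Bezout some exponent is divisible by \<open>order T\<close> and leaves remainder 1
  mod \<open>order H\<close>. The corresponding power kills \<open>t\<close> and fixes
  \<open>h\<close>; the other coordinate is symmetric.\<close>

lemma subgroup_mem_split:
  assumes K: "subgroup K (T \<times>\<times> H)" and th: "(t, h) \<in> K"
  shows "(t, \<one>\<^bsub>H\<^esub>) \<in> K" "(\<one>\<^bsub>T\<^esub>, h) \<in> K"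
proof -
  have c: "t \<in> carrier T" "h \<in> carrier H"
    using subgroup.subset[OF K] th by auto
  have pow: "(t [^]\<^bsub>T\<^esub> n, h [^]\<^bsub>H\<^esub> n) \<in> K" for n :: nat
    using subgroup.one_closed[OF K] subgroup.m_closed[OF K _ th]
    by (induction n) (fastforce simp: nat_pow_def)+
  have T1: "t [^]\<^bsub>T\<^esub> (order T * k) = \<one>\<^bsub>T\<^esub>" for k
    using c by (simp add: T.pow_order_eq_1 flip: T.nat_pow_pow)
  have H1: "h [^]\<^bsub>H\<^esub> (order H * k) = \<one>\<^bsub>H\<^esub>" for k
    using c by (simp add: H.pow_order_eq_1 flip: H.nat_pow_pow)
  have pos: "order T \<noteq> 0" "order H \<noteq> 0"
    using T.finite_carrier H.finite_carrier T.order_gt_0_iff_finite H.order_gt_0_iff_finite by auto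
  obtain x y where "order T * x = order H * y + 1"
    using bezout_nat[OF pos(1), of "order H"] coprime_orders by auto
  then have "h [^]\<^bsub>H\<^esub> (order T * x) = h"
    using H1[of y] c by (simp add: H.nat_pow_mult[symmetric])
  then show "(\<one>\<^bsub>T\<^esub>, h) \<in> K"
    using pow[of "order T * x"] T1[of x] by simp
  obtain x y where "order H * x = order T * y + 1"
    using bezout_nat[OF pos(2), of "order T"] coprime_orders by (auto simp: gcd.commute)
  then have "t [^]\<^bsub>T\<^esub> (order H * x) = t"
    using T1[of y] c by (simp add: T.nat_pow_mult[symmetric])
  then show "(t, \<one>\<^bsub>H\<^esub>) \<in> K"
    using pow[of "order H * x"] H1[of x] by simp
qed

text \<open>By coprimality a subgroup contains the separate coordinates of each of its elements, so
  it is full as soon as both projections are.\<close>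

lemma generate_eq_carrier_iff:
  assumes P: "P \<subseteq> carrier (T \<times>\<times> H)"
  shows "generate (T \<times>\<times> H) P = carrier (T \<times>\<times> H) \<longleftrightarrow>
    generate T (fst ` P) = carrier T \<and> generate H (snd ` P) = carrier H"
proof -
  let ?K = "generate (T \<times>\<times> H) P"
  have K: "subgroup ?K (T \<times>\<times> H)" using P by (rule G.generate_is_subgroup)
  have img: "generate T (fst ` P) = fst ` ?K" "generate H (snd ` P) = snd ` ?K"
    using fst.generate_img[OF P] snd.generate_img[OF P] by simp_all
  show ?thesis
  proof
    assume "?K = carrier (T \<times>\<times> H)"
    then show "generate T (fst ` P) = carrier T \<and> generate H (snd ` P) = carrier H"
      using T.one_closed H.one_closed unfolding img carrier_DirProd
      by (metis empty_iff fst_image_times snd_image_times)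
  next
    assume gen: "generate T (fst ` P) = carrier T \<and> generate H (snd ` P) = carrier H"
    have "(t, h) \<in> ?K" if "t \<in> carrier T" "h \<in> carrier H" for t h
    proof -
      have "t \<in> fst ` ?K" "h \<in> snd ` ?K" using that gen img by blast+
      then obtain h' t' where "(t, h') \<in> ?K" "(t', h) \<in> ?K" by auto
      then have "(t, \<one>\<^bsub>H\<^esub>) \<otimes>\<^bsub>T \<times>\<times> H\<^esub> (\<one>\<^bsub>T\<^esub>, h) \<in> ?K"
        using subgroup_mem_split[OF K] subgroup.m_closed[OF K] by blast
      then show ?thesis using that by simp
    qed
    then show "?K = carrier (T \<times>\<times> H)" using G.generate_incl[OF P] by auto
  qed
qed

text \<open>In the one-step recursion the coordinates of the new element are chosen independently,
  so a bound \<open>n\<close> holds for the product iff it holds for both factors; this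
  characterises the maximum.\<close>

lemma gens_needed_DirProd:
  assumes "P \<subseteq> carrier (T \<times>\<times> H)"
  shows "gens_needed (T \<times>\<times> H) P = max (gens_needed T (fst ` P)) (gens_needed H (snd ` P))"
proof -
  have sub: "fst ` P \<subseteq> carrier T" "snd ` P \<subseteq> carrier H"
    if "P \<subseteq> carrier (T \<times>\<times> H)" for P
    using that by auto
  have "gens_needed (T \<times>\<times> H) P \<le> n \<longleftrightarrow>
      gens_needed T (fst ` P) \<le> n \<and> gens_needed H (snd ` P) \<le> n"
    if "P \<subseteq> carrier (T \<times>\<times> H)" for n P
    using that
  proof (induction n arbitrary: P)
    case 0
    then show ?case
      using G.gens_needed_eq_0_iff[OF 0] T.gens_needed_eq_0_iff[OF sub(1)[OF 0]]
        H.gens_needed_eq_0_iff[OF sub(2)[OF 0]] generate_eq_carrier_iff[OF 0] by simp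
  next
    case (Suc n)
    have "gens_needed (T \<times>\<times> H) (insert (t, h) P) \<le> n \<longleftrightarrow>
        gens_needed T (insert t (fst ` P)) \<le> n \<and> gens_needed H (insert h (snd ` P)) \<le> n"
      if "t \<in> carrier T" "h \<in> carrier H" for t h
      using Suc.IH[of "insert (t, h) P"] Suc.prems that by simp
    then have "(\<exists>g \<in> carrier (T \<times>\<times> H). gens_needed (T \<times>\<times> H) (insert g P) \<le> n) \<longleftrightarrow>
        (\<exists>t \<in> carrier T. gens_needed T (insert t (fst ` P)) \<le> n) \<and>
        (\<exists>h \<in> carrier H. gens_needed H (insert h (snd ` P)) \<le> n)"
      by auto
    then show ?case
      using G.gens_needed_le_Suc_iff[OF Suc.prems] T.gens_needed_le_Suc_iff[OF sub(1)[OF Suc.prems]]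
        H.gens_needed_le_Suc_iff[OF sub(2)[OF Suc.prems]] by simp
  qed
  from this[OF assms, of "gens_needed (T \<times>\<times> H) P"]
    this[OF assms, of "max (gens_needed T (fst ` P)) (gens_needed H (snd ` P))"]
  show ?thesis by linarith
qed

lemma min_gens_DirProd: "min_gens (T \<times>\<times> H) = max (min_gens T) (min_gens H)"
  using gens_needed_DirProd[of "{}"] by (simp add: min_gens_eq_gens_needed)

end

section \<open>The game on a 2-group times a group of odd order\<close>

locale two_group_times_odd = T: finite_2_group T n + H: finite_group H
  for T :: "('a, 'c) monoid_scheme" and n and H :: "('b, 'd) monoid_scheme" +
  assumes odd_H: "odd (order H)"
begin

sublocale coprime_product T H
  by unfold_locales (simp add: T.order_eq odd_H coprime_left_2_iff_odd)

text \<open>Describes the first move that leaves \<open>1 \<times> H\<close>. Earlier selections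
  have trivial \<open>T\<close>-coordinate, so only the singleton of the new coordinate
  counts.\<close>

definition ranks_after_move :: "nat set" where
  "ranks_after_move = (\<lambda>t. gens_needed T {t}) ` (carrier T - {\<one>\<^bsub>T\<^esub>})"

text \<open>The order of \<open>t\<close> divides both an odd number and a power of two.
  Consequently every position outside \<open>1 \<times> H\<close> generates a subgroup of even
  order.\<close>

lemma odd_order_subgroup_fst:
  assumes K: "subgroup K (T \<times>\<times> H)" and odd: "odd (card K)" and th: "(t, h) \<in> K"
  shows "t = \<one>\<^bsub>T\<^esub>"
proof -
  have t: "t \<in> carrier T" using subgroup.subset[OF K] th by auto
  interpret K: group "(T \<times>\<times> H)\<lparr>carrier := K\<rparr>" using K G.subgroup_imp_group by blast
  have "(t, h) [^]\<^bsub>T \<times>\<times> H\<^esub> card K = \<one>\<^bsub>T \<times>\<times> H\<^esub>"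
    using K.pow_order_eq_1[of "(t, h)"] th by (simp add: order_def G.nat_pow_consistent[symmetric])
  then have "t [^]\<^bsub>T\<^esub> card K = \<one>\<^bsub>T\<^esub>" by (simp add: pow_DirProd)
  then have "T.ord t dvd card K" using T.pow_eq_id[OF t] by simp
  moreover have "T.ord t dvd 2 ^ n" using T.ord_dvd_group_order[OF t] T.order_eq by simp
  moreover have "coprime (card K) (2 ^ n)" using odd by simp
  ultimately have "T.ord t = 1" by (metis coprime_common_divisor_nat)
  then show ?thesis using T.ord_eq_1[OF t] by simp
qed

text \<open>Here \<open>F s b\<close> is the proposed nim-number of a position inside \<open>1 \<times> H\<close> that lacks \<open>s\<close>
  generators of \<open>H\<close> and has odd size iff \<open>b\<close>; the hypotheses say that it is the mex over the options.\<close>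

theorem GEN_nim_even_order:
  assumes nontriv: "carrier T \<noteq> {\<one>\<^bsub>T\<^esub>}"
    and avoid_even: "\<And>r s s' b. r \<in> ranks_after_move \<Longrightarrow> s' \<in> {s, s - 1} \<Longrightarrow>
        nim_by_rank (max r s') b \<noteq> F s b"
    and avoid_odd: "\<And>s s' b. s' \<in> {s, s - 1} \<Longrightarrow> F s' (\<not> b) \<noteq> F s b"
    and reach: "\<And>s b m. m < F s b \<Longrightarrow>
        (\<exists>r \<in> ranks_after_move. \<exists>s' \<in> {s, s - 1}. nim_by_rank (max r s') b = m)
        \<or> s > 0 \<and> F (s - 1) (\<not> b) = m \<or> \<not> b \<and> F s True = m"
  shows "GEN_nim (T \<times>\<times> H) = F (min_gens H) False"
proof -
  \<comment> \<open>These are the positions that generate a subgroup of odd order. All others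
    generate one of even order, so there the flag of \<open>nim_by_rank\<close> is even
    size.\<close>
  define odd_pos where "odd_pos P \<longleftrightarrow> P \<subseteq> {\<one>\<^bsub>T\<^esub>} \<times> carrier H" for P
  define f where "f P = (if odd_pos P then F (gens_needed H (snd ` P)) (odd (card P))
    else nim_by_rank (gens_needed (T \<times>\<times> H) P) (even (card P)))" for P
  have "gen_nim (T \<times>\<times> H) {} = f {}"
  proof (rule gen_nim_eqI[OF G.finite_carrier])
    fix P assume P: "P \<subseteq> carrier (T \<times>\<times> H)"
    note finP = G.finite_subset_carrier[OF P]
    have Q: "snd ` P \<subseteq> carrier H" using P by auto
    let ?d = "gens_needed (T \<times>\<times> H) P" and ?s = "gens_needed H (snd ` P)"
    have P_odd: "P = {\<one>\<^bsub>T\<^esub>} \<times> snd ` P" if "odd_pos P"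
      using that by (force simp: odd_pos_def)
    show "f P = 0" if gen: "generate (T \<times>\<times> H) P = carrier (T \<times>\<times> H)"
    proof -
      \<comment> \<open>As \<open>T\<close> is nontrivial, no position inside
        \<open>1 \<times> H\<close> is terminal; hence \<open>F 0\<close> need not vanish.\<close>
      have "\<not> odd_pos P"
      proof
        assume "odd_pos P"
        then have "fst ` P \<subseteq> {\<one>\<^bsub>T\<^esub>}" by (auto simp: odd_pos_def)
        then have "generate T (fst ` P) \<subseteq> {\<one>\<^bsub>T\<^esub>}"
          using T.generate_subgroup_incl[OF _ T.triv_subgroup] by blast
        then show False using gen generate_eq_carrier_iff[OF P] nontriv T.one_closed by blast
      qed
      then show ?thesis using gen G.gens_needed_eq_0_iff[OF P] by (simp add: f_def nim_by_rank_def)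
    qed
    assume "generate (T \<times>\<times> H) P \<noteq> carrier (T \<times>\<times> H)"
    then have pos: "?d > 0" using G.gens_needed_eq_0_iff[OF P] by simp
    have stays_even: "\<not> odd_pos (insert g P)" if "\<not> odd_pos P" for g
      using that by (auto simp: odd_pos_def)
    have odd_insert: "odd_pos (insert (t, h) P) \<longleftrightarrow> t = \<one>\<^bsub>T\<^esub>"
      if "odd_pos P" "h \<in> carrier H" for t h
      using that by (auto simp: odd_pos_def)
    have rank_insert: "gens_needed (T \<times>\<times> H) (insert (t, h) P)
        = max (gens_needed T {t}) (gens_needed H (insert h (snd ` P)))"
      if "odd_pos P" "t \<in> carrier T" "h \<in> carrier H" for t h
    proof -
      have "gens_needed T (insert t (fst ` P)) = gens_needed T {t}"
      proof (cases "P = {}")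
        case False
        then have "fst ` P = {\<one>\<^bsub>T\<^esub>}" using P_odd[OF that(1)] by (metis fst_image_times image_is_empty)
        then show ?thesis
          using T.gens_needed_insert_one[of "{t}"] that by (simp add: insert_commute)
      qed simp
      then show ?thesis using gens_needed_DirProd[of "insert (t, h) P"] P that by simp
    qed
    have card_insert: "even (card (insert g P)) \<longleftrightarrow> odd (card P)" if "g \<notin> P" for g
      using that finP by simp
    show "f (insert g P) \<noteq> f P" if g: "g \<in> carrier (T \<times>\<times> H) - P" for g
    proof (cases "odd_pos P")
      case False
      then show ?thesis
        using stays_even[OF False] g card_insert[of g]
          nim_by_rank_avoid[OF pos G.gens_needed_insert_cases[OF P, of g], of "even (card P)"]
        by (simp add: f_def)
    next
      case True
      obtain t h where th: "g = (t, h)" "t \<in> carrier T" "h \<in> carrier H" using g by auto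
      have s': "gens_needed H (insert h (snd ` P)) \<in> {?s, ?s - 1}"
        using H.gens_needed_insert_cases[OF Q th(3)] .
      show ?thesis
      proof (cases "t = \<one>\<^bsub>T\<^esub>")
        case t: True
        then show ?thesis
          using avoid_odd[OF s', of "odd (card P)"] True g th card_insert[of g]
          by (simp add: f_def odd_insert)
      next
        case False
        then have "gens_needed T {t} \<in> ranks_after_move" using th by (auto simp: ranks_after_move_def)
        \<comment> \<open>Size and subgroup order change parity together in this move, so the new
          flag \<open>even (card (insert g P))\<close> equals \<open>odd (card P)\<close>.\<close>
        from avoid_even[OF this s', of "odd (card P)"] show ?thesis
          using False True g th card_insert[of g] by (simp add: f_def odd_insert rank_insert)
      qed
    qed
    show "\<exists>g \<in> carrier (T \<times>\<times> H) - P. f (insert g P) = m" if m: "m < f P" for m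
    proof (cases "odd_pos P")
      case False
      have "m < nim_by_rank ?d (even (card P))" using m False by (simp add: f_def)
      from nim_by_rank_reach[OF this] show ?thesis
      proof
        assume m: "nim_by_rank (?d - 1) (\<not> even (card P)) = m"
        obtain g where "g \<in> carrier (T \<times>\<times> H) - P" "gens_needed (T \<times>\<times> H) (insert g P) = ?d - 1"
          using G.gens_needed_decrease[OF P pos] .
        then show ?thesis
          using m stays_even[OF False] card_insert[of g] by (intro bexI[of _ g]) (auto simp: f_def)
      next
        assume m: "\<not> even (card P) \<and> nim_by_rank ?d True = m"
        \<comment> \<open>The size is odd, and a subgroup of odd order would lie in
          \<open>1 \<times> H\<close>. So a move inside the generated subgroup exists.\<close>
        have "\<not> subgroup P (T \<times>\<times> H)"
        proof
          assume "subgroup P (T \<times>\<times> H)"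
          then have "odd_pos P"
            using odd_order_subgroup_fst m P by (force simp: odd_pos_def)
          with False show False ..
        qed
        then obtain g where g: "g \<in> generate (T \<times>\<times> H) P - P" using G.ex_generate_diff[OF P] by blast
        then have "g \<in> carrier (T \<times>\<times> H) - P" using G.generate_in_carrier[OF P] by blast
        then show ?thesis
          using g m stays_even[OF False] card_insert[of g] G.gens_needed_insert_generate[OF P, of g]
          by (intro bexI[of _ g]) (auto simp: f_def)
      qed
    next
      case True
      have "m < F ?s (odd (card P))" using m True by (simp add: f_def)
      from reach[OF this] consider
          (even) r s' where "r \<in> ranks_after_move" "s' \<in> {?s, ?s - 1}"
            "nim_by_rank (max r s') (odd (card P)) = m"
        | (decrease) "?s > 0" "F (?s - 1) (\<not> odd (card P)) = m"
        | (stay) "\<not> odd (card P)" "F ?s True = m"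
        by (elim disjE bexE conjE) (assumption | blast)+
      then show ?thesis
      proof cases
        case even
        obtain t where t: "t \<in> carrier T" "t \<noteq> \<one>\<^bsub>T\<^esub>" "r = gens_needed T {t}"
          using even(1) by (auto simp: ranks_after_move_def)
        \<comment> \<open>The \<open>H\<close>-coordinate may be one used before, such as the
          identity: the nontrivial \<open>t\<close> makes the pair new.\<close>
        obtain h where h: "h \<in> carrier H" "gens_needed H (insert h (snd ` P)) = s'"
        proof (cases "s' = ?s")
          case True
          then show ?thesis using that[OF H.one_closed] H.gens_needed_insert_one[OF Q] by simp
        next
          case False
          then have "?s > 0" "s' = ?s - 1" using even(2) by auto
          then show ?thesis using H.gens_needed_decrease[OF Q] that by (metis Diff_iff)
        qed
        have "(t, h) \<notin> P" using t True by (auto simp: odd_pos_def)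
        then show ?thesis
          using t h even True card_insert[of "(t, h)"]
          by (intro bexI[of _ "(t, h)"]) (auto simp: f_def odd_insert rank_insert)
      next
        case decrease
        obtain h where h: "h \<in> carrier H - snd ` P" "gens_needed H (insert h (snd ` P)) = ?s - 1"
          using H.gens_needed_decrease[OF Q decrease(1)] .
        have "(\<one>\<^bsub>T\<^esub>, h) \<notin> P" using h by force
        then show ?thesis
          using h decrease True card_insert[of "(\<one>\<^bsub>T\<^esub>, h)"]
          by (intro bexI[of _ "(\<one>\<^bsub>T\<^esub>, h)"]) (auto simp: f_def odd_insert)
      next
        case stay
        have "card P = card (snd ` P)"
          using P_odd[OF True] by (metis card_cartesian_product_singleton)
        \<comment> \<open>The set has even size while \<open>H\<close> has odd order.\<close>
        then have "\<not> subgroup (snd ` P) H"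
          using stay odd_H H.lagrange[of "snd ` P"] by (metis dvd_mult)
        then obtain h where h: "h \<in> generate H (snd ` P) - snd ` P"
          using H.ex_generate_diff[OF Q] by blast
        then have "h \<in> carrier H" "(\<one>\<^bsub>T\<^esub>, h) \<notin> P" using H.generate_in_carrier[OF Q] by force+
        then show ?thesis
          using h stay True card_insert[of "(\<one>\<^bsub>T\<^esub>, h)"] H.gens_needed_insert_generate[OF Q, of h]
          by (intro bexI[of _ "(\<one>\<^bsub>T\<^esub>, h)"]) (auto simp: f_def odd_insert)
      qed
    qed
  qed auto
  then show ?thesis by (simp add: GEN_nim_def min_gens_eq_gens_needed f_def odd_pos_def)
qed

end

section \<open>Values of the game\<close>

context two_group_times_odd
begin

section \<open>The ranks left after a first nontrivial element of the 2-group\<close>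

lemma ranks_after_move_subset: "ranks_after_move \<subseteq> {min_gens T, min_gens T - 1}"
  using T.gens_needed_insert_cases[of "{}"] by (auto simp: ranks_after_move_def min_gens_eq_gens_needed)

lemma rank_0_iff: "t \<in> carrier T \<Longrightarrow> gens_needed T {t} = 0 \<longleftrightarrow> T.ord t = order T"
  using T.gens_needed_eq_0_iff[of "{t}"] T.generate_singleton_eq_carrier_iff[of t] by simp

lemma ranks_after_move_order_2:
  assumes two: "order T = 2"
  shows "ranks_after_move = {0}"
proof -
  have "gens_needed T {t} = 0" if t: "t \<in> carrier T - {\<one>\<^bsub>T\<^esub>}" for t
  proof -
    have "T.ord t dvd 2" "T.ord t \<noteq> 1"
      using T.ord_dvd_group_order[of t] T.ord_eq_1[of t] t two by auto
    then have "T.ord t = 2" by (metis prime_nat_iff two_is_prime_nat)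
    then show ?thesis using t two rank_0_iff by simp
  qed
  moreover have "carrier T - {\<one>\<^bsub>T\<^esub>} \<noteq> {}"
    using two card_mono[of "{\<one>\<^bsub>T\<^esub>}" "carrier T"] by (auto simp: order_def)
  ultimately show ?thesis unfolding ranks_after_move_def by force
qed

text \<open>A generator leaves rank 0. Its square has half the order, which is neither 1 nor the
  full order, so it leaves rank 1.\<close>

lemma ranks_after_move_cyclic:
  assumes "min_gens T = 1" "order T \<noteq> 2"
  shows "ranks_after_move = {0, 1}"
proof
  show "ranks_after_move \<subseteq> {0, 1}" using ranks_after_move_subset assms by auto
  obtain x where x: "x \<in> carrier T" "T.ord x = order T" using T.min_gens_le_1_iff assms by auto
  have x1: "x \<noteq> \<one>\<^bsub>T\<^esub>"
    using x T.min_gens_eq_0_iff assms T.one_closed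
    by (metis T.ord_eq_1 card_1_singletonE One_nat_def order_def singletonD zero_neq_one)
  have "0 \<in> ranks_after_move"
    using x x1 rank_0_iff by (force simp: ranks_after_move_def)
  moreover
  let ?y = "x [^]\<^bsub>T\<^esub> (2::nat)"
  have y: "?y \<in> carrier T" "T.ord ?y = order T div 2"
    using x x1 T.even_ord[of x] T.ord_pow[of x 2] by auto
  have "order T > 0" using T.finite_carrier T.order_gt_0_iff_finite by simp
  then have "T.ord ?y \<noteq> order T" "T.ord ?y \<noteq> 1"
    using y assms x T.even_ord[OF x(1) x1] by (auto elim!: evenE)
  then have "?y \<noteq> \<one>\<^bsub>T\<^esub>" "gens_needed T {?y} \<noteq> 0"
    using y rank_0_iff by auto
  then have "gens_needed T {?y} \<in> ranks_after_move" "gens_needed T {?y} = 1"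
    using y ranks_after_move_subset assms by (auto simp: ranks_after_move_def)
  then have "1 \<in> ranks_after_move" by simp
  ultimately show "{0, 1} \<subseteq> ranks_after_move" by simp
qed

text \<open>Two distinct nontrivial elements generate a subgroup with at least three elements and
  order dividing four, hence everything; no single element suffices.\<close>

lemma ranks_after_move_Klein_four:
  assumes four: "order T = 4" and sq: "\<And>x. x \<in> carrier T \<Longrightarrow> x \<otimes>\<^bsub>T\<^esub> x = \<one>\<^bsub>T\<^esub>"
  shows "ranks_after_move = {1}" "min_gens T = 2"
proof -
  have ord: "T.ord x \<le> 2" if "x \<in> carrier T" for x
    using T.pow_eq_id[OF that, of 2] sq[OF that] that by (auto simp: T.pow_2 dest: dvd_imp_le)
  have one: "gens_needed T {t} = 1" if t: "t \<in> carrier T - {\<one>\<^bsub>T\<^esub>}" for t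
  proof -
    have "card {\<one>\<^bsub>T\<^esub>, t} \<le> 2" by (simp add: card_insert_if)
    then have "\<not> carrier T \<subseteq> {\<one>\<^bsub>T\<^esub>, t}"
      using four card_mono[of "{\<one>\<^bsub>T\<^esub>, t}" "carrier T"] by (auto simp: order_def)
    then obtain u where u: "u \<in> carrier T" "u \<noteq> \<one>\<^bsub>T\<^esub>" "u \<noteq> t" by blast
    let ?K = "generate T {u, t}"
    have tu: "{u, t} \<subseteq> carrier T" using t u by auto
    note K = T.generate_is_subgroup[OF tu]
    have fin: "finite ?K" using T.generate_incl[OF tu] T.finite_subset_carrier by blast
    have "{\<one>\<^bsub>T\<^esub>, u, t} \<subseteq> ?K" by (auto intro: generate.one generate.incl)
    from card_mono[OF fin this] have "card ?K \<ge> 3" using t u by (auto simp: card_insert_if split: if_splits)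
    moreover have "card ?K dvd 4" using T.lagrange[OF K] four by (metis dvd_triv_right)
    moreover from this have "card ?K \<le> 4" by (rule dvd_imp_le) simp
    moreover have "card ?K \<noteq> 3" using \<open>card ?K dvd 4\<close> by auto
    ultimately have "card ?K = card (carrier T)" using four by (simp add: order_def)
    then have "?K = carrier T"
      using T.generate_incl[OF tu] T.finite_carrier by (intro card_subset_eq) auto
    then have "gens_needed T {t} \<le> 1"
      using T.gens_needed_le_Suc_iff[of "{t}" 0] T.gens_needed_eq_0_iff[OF tu] t u by auto
    moreover have "gens_needed T {t} \<noteq> 0"
      using rank_0_iff[of t] ord[of t] t four by auto
    ultimately show ?thesis by simp
  qed
  have "carrier T - {\<one>\<^bsub>T\<^esub>} \<noteq> {}"
    using four card_mono[of "{\<one>\<^bsub>T\<^esub>}" "carrier T"] by (auto simp: order_def)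
  with one show "ranks_after_move = {1}" unfolding ranks_after_move_def by force
  then have "min_gens T \<le> 2" using ranks_after_move_subset by simp linarith
  moreover have "\<not> min_gens T \<le> 1" using T.min_gens_le_1_iff ord four by force
  ultimately show "min_gens T = 2" by simp
qed

text \<open>The first element of a generating pair leaves rank 1. If no nontrivial element left rank
  2, each would extend to a generating pair, which forces the Klein four-group.\<close>

lemma ranks_after_move_rank_2:
  assumes rank: "min_gens T = 2"
    and not_Klein: "\<not> (order T = 4 \<and> (\<forall>x \<in> carrier T. x \<otimes>\<^bsub>T\<^esub> x = \<one>\<^bsub>T\<^esub>))"
  shows "ranks_after_move = {1, 2}"
proof
  show sub: "ranks_after_move \<subseteq> {1, 2}" using ranks_after_move_subset rank by auto
  have rank': "gens_needed T {} = 2" using rank by (simp add: min_gens_eq_gens_needed)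
  obtain g where g: "g \<in> carrier T" "gens_needed T {g} = 1"
    using T.gens_needed_decrease[of "{}"] rank' by auto
  have "g \<noteq> \<one>\<^bsub>T\<^esub>" using g T.gens_needed_insert_one[of "{}"] rank' by auto
  then have "1 \<in> ranks_after_move" using g unfolding ranks_after_move_def by force
  moreover have "2 \<in> ranks_after_move"
  proof (rule ccontr)
    assume "2 \<notin> ranks_after_move"
    then have one: "gens_needed T {t} \<le> Suc 0" if "t \<in> carrier T" "t \<noteq> \<one>\<^bsub>T\<^esub>" for t
      using sub that unfolding ranks_after_move_def by fastforce
    have "\<exists>u \<in> carrier T. generate T {t, u} = carrier T"
      if t: "t \<in> carrier T" "t \<noteq> \<one>\<^bsub>T\<^esub>" for t
    proof -
      obtain u where u: "u \<in> carrier T" "gens_needed T {u, t} = 0"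
        using T.gens_needed_le_Suc_iff[of "{t}" 0] one[OF t] t by auto
      then have "generate T {u, t} = carrier T" using T.gens_needed_eq_0_iff[of "{u, t}"] t by simp
      then show ?thesis using u by (metis insert_commute)
    qed
    from T.Klein_four_if_pairs_generate[OF this rank] show False using not_Klein by blast
  qed
  ultimately show "{1, 2} \<subseteq> ranks_after_move" by simp
qed

section \<open>Nim tables for the types of 2-groups\<close>

lemmas nim_table_simps = nim_by_rank_def less_Suc_eq numeral_eq_Suc max_def

lemma GEN_nim_order_2:
  assumes two: "order T = 2"
  shows "GEN_nim (T \<times>\<times> H) = (if min_gens H = 0 then 2 else if min_gens H = 1 then 4 else 0)"
proof -
  \<comment> \<open>Filled in by increasing \<open>s\<close>, with \<open>True\<close> before
    \<open>False\<close> because an even-sized position can stay at rank \<open>s\<close>. The 4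
    arises from options 0 and 2 that leave \<open>1 \<times> H\<close>, together with
    \<open>F 0 True = 1\<close> and \<open>F 1 True = 3\<close>.\<close>
  define F :: "nat \<Rightarrow> bool \<Rightarrow> nat" where
    "F s b = (if s = 0 then (if b then 1 else 2) else if s = 1 then (if b then 3 else 4)
      else if s = 2 then (if b then 2 else 0) else if b then 1 else 0)" for s b
  note R = ranks_after_move_order_2[OF two]
  have "GEN_nim (T \<times>\<times> H) = F (min_gens H) False"
  proof (rule GEN_nim_even_order)
    show "carrier T \<noteq> {\<one>\<^bsub>T\<^esub>}" using two by (auto simp: order_def)
  qed (auto simp: R F_def nim_table_simps split: if_splits)
  then show ?thesis by (simp add: F_def)
qed

lemma GEN_nim_cyclic:
  assumes "min_gens T = 1" "order T \<noteq> 2"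
  shows "GEN_nim (T \<times>\<times> H) = (if min_gens H \<le> 1 then 1 else 0)"
proof -
  \<comment> \<open>Moves in \<open>T\<close> can leave rank 0 or 1 already for
    \<open>s = 0\<close>, so \<open>s = 0\<close> and \<open>s = 1\<close> have equal
    values.\<close>
  define F :: "nat \<Rightarrow> bool \<Rightarrow> nat" where
    "F s b = (if s \<le> 1 then (if b then 2 else 1)
      else if s = 2 then (if b then 2 else 0) else if b then 1 else 0)" for s b
  note R = ranks_after_move_cyclic[OF assms]
  have "GEN_nim (T \<times>\<times> H) = F (min_gens H) False"
  proof (rule GEN_nim_even_order)
    show "carrier T \<noteq> {\<one>\<^bsub>T\<^esub>}" using T.min_gens_eq_0_iff assms by auto
  qed (auto simp: R F_def nim_table_simps split: if_splits)
  then show ?thesis by (simp add: F_def)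
qed

lemma GEN_nim_Klein_four:
  assumes four: "order T = 4" and sq: "\<And>x. x \<in> carrier T \<Longrightarrow> x \<otimes>\<^bsub>T\<^esub> x = \<one>\<^bsub>T\<^esub>"
  shows "GEN_nim (T \<times>\<times> H) = (if min_gens H \<le> 2 then 1 else 0)"
proof -
  \<comment> \<open>For \<open>s \<le> 1\<close> every move leaving \<open>1 \<times> H\<close>
    leaves exactly rank 1. At \<open>s = 2\<close> and even size the options are 2 and
    \<open>F 1 True = 0\<close>, so the value is still 1.\<close>
  define F :: "nat \<Rightarrow> bool \<Rightarrow> nat" where
    "F s b = (if s \<le> 1 then (if b then 0 else 1) else if s = 2 then (if b then 2 else 1)
      else if s = 3 then (if b then 2 else 0) else if b then 1 else 0)" for s b
  note R = ranks_after_move_Klein_four(1)[OF assms]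
  have "GEN_nim (T \<times>\<times> H) = F (min_gens H) False"
  proof (rule GEN_nim_even_order)
    show "carrier T \<noteq> {\<one>\<^bsub>T\<^esub>}" using four by (auto simp: order_def)
  qed (auto simp: R F_def nim_table_simps split: if_splits)
  then show ?thesis by (simp add: F_def)
qed

lemma GEN_nim_rank_2:
  assumes rank: "min_gens T = 2"
    and not_Klein: "\<not> (order T = 4 \<and> (\<forall>x \<in> carrier T. x \<otimes>\<^bsub>T\<^esub> x = \<one>\<^bsub>T\<^esub>))"
  shows "GEN_nim (T \<times>\<times> H) = 0"
proof -
  \<comment> \<open>At even size every option is nonzero. At odd size some move leaving
    \<open>1 \<times> H\<close> reaches 0, and for \<open>s \<le> 2\<close> another reaches
    1.\<close>
  define F :: "nat \<Rightarrow> bool \<Rightarrow> nat" where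
    "F s b = (if \<not> b then 0 else if s \<le> 2 then 2 else 1)" for s b
  note R = ranks_after_move_rank_2[OF assms]
  have "GEN_nim (T \<times>\<times> H) = F (min_gens H) False"
  proof (rule GEN_nim_even_order)
    show "carrier T \<noteq> {\<one>\<^bsub>T\<^esub>}" using T.min_gens_eq_0_iff assms by auto
  qed (auto simp: R F_def nim_table_simps split: if_splits)
  then show ?thesis by (simp add: F_def)
qed

text \<open>After leaving \<open>1 \<times> H\<close> at least two generators are lacking, where
  \<open>nim_by_rank\<close> is 0 for flag \<open>True\<close> and 1 or 2 for \<open>False\<close>.
  Thus the values inside \<open>1 \<times> H\<close> simply alternate with the parity of the
  size.\<close>

lemma GEN_nim_rank_ge_3:
  assumes rank: "min_gens T \<ge> 3"
  shows "GEN_nim (T \<times>\<times> H) = 0"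
proof -
  define F :: "nat \<Rightarrow> bool \<Rightarrow> nat" where "F s b = (if b then 1 else 0)" for s b
  have ge: "r \<ge> 2" if "r \<in> ranks_after_move" for r
    using ranks_after_move_subset rank that by fastforce
  have nontriv: "carrier T \<noteq> {\<one>\<^bsub>T\<^esub>}" using T.min_gens_eq_0_iff assms by auto
  then obtain r where r: "r \<in> ranks_after_move"
    using T.one_closed unfolding ranks_after_move_def by blast
  have "GEN_nim (T \<times>\<times> H) = F (min_gens H) False"
  proof (rule GEN_nim_even_order[OF nontriv])
    show "nim_by_rank (max r s') b \<noteq> F s b" if "r \<in> ranks_after_move" for r s s' b
      using ge[OF that] by (auto simp: nim_by_rank_def F_def)
    show "(\<exists>r \<in> ranks_after_move. \<exists>s' \<in> {s, s - 1}. nim_by_rank (max r s') b = m)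
        \<or> s > 0 \<and> F (s - 1) (\<not> b) = m \<or> \<not> b \<and> F s True = m" if "m < F s b" for s b m
      using that r ge[OF r] by (intro disjI1 bexI[of _ r] bexI[of _ s])
        (auto simp: nim_by_rank_def F_def split: if_splits)
  qed (auto simp: F_def)
  then show ?thesis by (simp add: F_def)
qed

section \<open>The isomorphism conditions in terms of orders and ranks\<close>

lemma order_DirProd: "order (T \<times>\<times> H) = 2 ^ n * order H"
  using T.order_eq by (simp add: order_def card_cartesian_product)

lemma four_dvd_order_iff: "4 dvd order (T \<times>\<times> H) \<longleftrightarrow> n \<ge> 2"
proof -
  have "coprime ((2::nat) ^ 2) (order H)"
    using odd_H by (simp only: coprime_power_left_iff coprime_left_2_iff_odd) simp
  from coprime_dvd_mult_left_iff[OF this]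
  have "4 dvd (2::nat) ^ n * order H \<longleftrightarrow> (2::nat) ^ 2 dvd 2 ^ n" by simp
  also have "\<dots> \<longleftrightarrow> n \<ge> 2" using dvd_power_iff_le[of 2 2 n] by simp
  finally show ?thesis by (simp add: order_DirProd)
qed

lemma iso_cyclic_4k_iff:
  "(\<exists>k::nat. k \<ge> 1 \<and> T \<times>\<times> H \<cong> integer_mod_group (4 * k)) \<longleftrightarrow>
    n \<ge> 2 \<and> min_gens T \<le> 1 \<and> min_gens H \<le> 1"
proof -
  have pos: "order (T \<times>\<times> H) > 0" using G.finite_carrier G.order_gt_0_iff_finite by simp
  have "(\<exists>k::nat. k \<ge> 1 \<and> T \<times>\<times> H \<cong> integer_mod_group (4 * k)) \<longleftrightarrow>
      (\<exists>k::nat. k \<ge> 1 \<and> order (T \<times>\<times> H) = 4 * k) \<and> min_gens (T \<times>\<times> H) \<le> 1"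
    using G.iso_integer_mod_group_iff by auto
  also have "(\<exists>k::nat. k \<ge> 1 \<and> order (T \<times>\<times> H) = 4 * k) \<longleftrightarrow> n \<ge> 2"
    using pos unfolding four_dvd_order_iff[symmetric] by (auto simp: dvd_def) 
  finally show ?thesis by (simp add: min_gens_DirProd)
qed

lemma iso_Z2_iff:
  "T \<times>\<times> H \<cong> integer_mod_group 2 \<longleftrightarrow> n = 1 \<and> min_gens T \<le> 1 \<and> min_gens H = 0"
proof -
  have "order (T \<times>\<times> H) = 2 \<longleftrightarrow> n = 1 \<and> order H = 1"
  proof
    assume two: "order (T \<times>\<times> H) = 2"
    then have "n < 2" using four_dvd_order_iff by auto
    moreover have "n \<noteq> 0" using two odd_H by (intro notI) (simp add: order_DirProd)
    ultimately have "n = 1" by simp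
    then show "n = 1 \<and> order H = 1" using two by (simp add: order_DirProd)
  qed (simp add: order_DirProd)
  then show ?thesis
    using G.iso_integer_mod_group_iff[of 2] H.min_gens_eq_0_iff_order by (auto simp: min_gens_DirProd)
qed

lemma iso_cyclic_4k_2_iff:
  "(\<exists>k::nat. k \<ge> 1 \<and> T \<times>\<times> H \<cong> integer_mod_group (4 * k + 2)) \<longleftrightarrow>
    n = 1 \<and> min_gens T \<le> 1 \<and> min_gens H = 1"
proof -
  have "(\<exists>k::nat. k \<ge> 1 \<and> order (T \<times>\<times> H) = 4 * k + 2) \<longleftrightarrow> n = 1 \<and> order H \<noteq> 1"
  proof
    assume "\<exists>k::nat. k \<ge> 1 \<and> order (T \<times>\<times> H) = 4 * k + 2"
    then obtain k where k: "k \<ge> 1" "order (T \<times>\<times> H) = 4 * k + 2" by blast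
    have "\<not> 4 dvd 4 * k + 2" by presburger
    then have "n < 2" using k four_dvd_order_iff by auto
    moreover have "n \<noteq> 0"
    proof
      assume "n = 0"
      then have "order H = 4 * k + 2" using k by (simp add: order_DirProd)
      then show False using odd_H by simp
    qed
    ultimately have "n = 1" by simp
    then show "n = 1 \<and> order H \<noteq> 1" using k by (simp add: order_DirProd)
  next
    assume n: "n = 1 \<and> order H \<noteq> 1"
    obtain k where "order H = 2 * k + 1" using odd_H by (elim oddE)
    then show "\<exists>k::nat. k \<ge> 1 \<and> order (T \<times>\<times> H) = 4 * k + 2"
      using n by (intro exI[of _ k]) (simp add: order_DirProd)
  qed
  moreover have "(\<exists>k::nat. k \<ge> 1 \<and> T \<times>\<times> H \<cong> integer_mod_group (4 * k + 2)) \<longleftrightarrow>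
      (\<exists>k::nat. k \<ge> 1 \<and> order (T \<times>\<times> H) = 4 * k + 2) \<and> min_gens (T \<times>\<times> H) \<le> 1"
    using G.iso_integer_mod_group_iff by auto
  ultimately show ?thesis using H.min_gens_eq_0_iff_order by (auto simp: min_gens_DirProd)
qed

text \<open>To cancel \<open>H\<close>, orders are compared first. An isomorphism then sends
  \<open>(x, 1)\<close>, whose fourth power is trivial, to a pair with trivial coordinate in the odd
  group \<open>H\<close>; such a pair squares to the identity, and injectivity carries this back to
  \<open>x\<close>.\<close>

lemma iso_Klein_four_times_iff:
  "T \<times>\<times> H \<cong> (integer_mod_group 2 \<times>\<times> integer_mod_group 2) \<times>\<times> H \<longleftrightarrow>
    order T = 4 \<and> (\<forall>x \<in> carrier T. x \<otimes>\<^bsub>T\<^esub> x = \<one>\<^bsub>T\<^esub>)"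
    (is "_ \<cong> ?V \<times>\<times> H \<longleftrightarrow> _")
proof
  have V: "group ?V" by (intro DirProd_group) simp_all
  have cV: "carrier ?V = {0, 1} \<times> {0, 1}" by (auto simp: carrier_integer_mod_group)
  interpret VH: group "?V \<times>\<times> H" by (rule DirProd_group[OF V H.group_axioms])
  assume iso: "T \<times>\<times> H \<cong> ?V \<times>\<times> H"
  have "order T * order H = 4 * order H"
    using iso_same_card[OF iso] by (simp add: carrier_integer_mod_group order_def card_cartesian_product)
  moreover have "order H > 0" using H.finite_carrier H.order_gt_0_iff_finite by simp
  ultimately have four: "order T = 4" by simp
  obtain f where f: "f \<in> iso (T \<times>\<times> H) (?V \<times>\<times> H)" using iso by (auto simp: is_iso_def)
  interpret f: group_hom "T \<times>\<times> H" "?V \<times>\<times> H" f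
    using f by unfold_locales (auto simp: iso_def)
  have "x \<otimes>\<^bsub>T\<^esub> x = \<one>\<^bsub>T\<^esub>" if x: "x \<in> carrier T" for x
  proof -
    have c: "(x, \<one>\<^bsub>H\<^esub>) \<in> carrier (T \<times>\<times> H)" using x by simp
    obtain v h where vh: "f (x, \<one>\<^bsub>H\<^esub>) = (v, h)" "v \<in> carrier ?V" "h \<in> carrier H"
      using f.hom_closed[OF c] by (metis carrier_DirProd mem_Sigma_iff surj_pair)
    have "(x, \<one>\<^bsub>H\<^esub>) [^]\<^bsub>T \<times>\<times> H\<^esub> (4::nat) = \<one>\<^bsub>T \<times>\<times> H\<^esub>"
      using T.pow_order_eq_1[OF x] four by (simp add: pow_DirProd)
    then have "(v, h) [^]\<^bsub>?V \<times>\<times> H\<^esub> (4::nat) = \<one>\<^bsub>?V \<times>\<times> H\<^esub>"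
      using f.hom_nat_pow[OF c, of 4] f.hom_one vh by simp
    then have "h [^]\<^bsub>H\<^esub> (4::nat) = \<one>\<^bsub>H\<^esub>" by (simp add: pow_DirProd)
    then have "H.ord h dvd 2 ^ 2" using H.pow_eq_id[OF vh(3)] by simp
    moreover have "H.ord h dvd order H" using H.ord_dvd_group_order[OF vh(3)] .
    moreover have "coprime (order H) (2 ^ 2)"
      using odd_H by (simp only: coprime_power_right_iff coprime_right_2_iff_odd) simp
    ultimately have "H.ord h = 1" by (metis coprime_common_divisor_nat)
    then have h: "h = \<one>\<^bsub>H\<^esub>" using H.ord_eq_1 vh by blast
    have "f ((x, \<one>\<^bsub>H\<^esub>) \<otimes>\<^bsub>T \<times>\<times> H\<^esub> (x, \<one>\<^bsub>H\<^esub>)) = (v, h) \<otimes>\<^bsub>?V \<times>\<times> H\<^esub> (v, h)"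
      using f.hom_mult[OF c c] vh by simp
    also have "\<dots> = \<one>\<^bsub>?V \<times>\<times> H\<^esub>" using vh(2) h unfolding cV by auto
    finally have "f ((x, \<one>\<^bsub>H\<^esub>) \<otimes>\<^bsub>T \<times>\<times> H\<^esub> (x, \<one>\<^bsub>H\<^esub>)) = f \<one>\<^bsub>T \<times>\<times> H\<^esub>"
      using f.hom_one by simp
    moreover have "inj_on f (carrier (T \<times>\<times> H))" using f by (simp add: iso_def bij_betw_def)
    ultimately have "(x, \<one>\<^bsub>H\<^esub>) \<otimes>\<^bsub>T \<times>\<times> H\<^esub> (x, \<one>\<^bsub>H\<^esub>) = \<one>\<^bsub>T \<times>\<times> H\<^esub>"
      using c by (meson G.m_closed G.one_closed inj_onD)
    then show ?thesis by simp
  qed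
  with four show "order T = 4 \<and> (\<forall>x \<in> carrier T. x \<otimes>\<^bsub>T\<^esub> x = \<one>\<^bsub>T\<^esub>)" by blast
next
  assume "order T = 4 \<and> (\<forall>x \<in> carrier T. x \<otimes>\<^bsub>T\<^esub> x = \<one>\<^bsub>T\<^esub>)"
  then have "T \<cong> ?V" using T.iso_Klein_four by blast
  then show "T \<times>\<times> H \<cong> ?V \<times>\<times> H"
    by (rule T.DirProd_iso_trans) (rule iso_refl)
qed

end

theorem theorem4p11:
  fixes T :: "('a, 'c) monoid_scheme" and H :: "('b, 'd) monoid_scheme"
  assumes "group T" and "finite (carrier T)" and "\<exists>n. order T = 2 ^ n"
      and "group H" and "finite (carrier H)" and "odd (order H)"
  shows "GEN_nim (T \<times>\<times> H) =
    (if odd (order (T \<times>\<times> H)) \<and> min_gens (T \<times>\<times> H) \<ge> 3 then 1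
     else if \<exists>k::nat. k \<ge> 1 \<and> (T \<times>\<times> H) \<cong> integer_mod_group (4 * k) then 1
     else if (T \<times>\<times> H) \<cong> ((integer_mod_group 2 \<times>\<times> integer_mod_group 2) \<times>\<times> H)
             \<and> min_gens H \<le> 2 then 1
     else if (T \<times>\<times> H) \<cong> integer_mod_group 2 then 2
     else if odd (order (T \<times>\<times> H)) \<and> min_gens (T \<times>\<times> H) \<in> {1, 2} then 2
     else if \<exists>k::nat. k \<ge> 1 \<and> (T \<times>\<times> H) \<cong> integer_mod_group (4 * k + 2) then 4
     else 0)"
proof -
  obtain n where n: "order T = 2 ^ n" using assms(3) by blast
  interpret two_group_times_odd T n H
    using assms n by (simp add: two_group_times_odd_def two_group_times_odd_axioms_def
        finite_2_group_def finite_2_group_axioms_def finite_group_def finite_group_axioms_def)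
  let ?Klein = "order T = 4 \<and> (\<forall>x \<in> carrier T. x \<otimes>\<^bsub>T\<^esub> x = \<one>\<^bsub>T\<^esub>)"
  note iffs = iso_cyclic_4k_iff iso_Klein_four_times_iff iso_Z2_iff iso_cyclic_4k_2_iff
  have parity: "odd (order (T \<times>\<times> H)) \<longleftrightarrow> n = 0" using odd_H by (simp add: order_DirProd)
  have rank_T: "min_gens T = 0 \<longleftrightarrow> n = 0" using T.min_gens_eq_0_iff_order n by simp
  have two: "order T = 2 \<longleftrightarrow> n = 1" using n power_inject_exp[of "2::nat" n 1] by simp
  \<comment> \<open>The set \<open>{0}\<close> of ranks after a move lies in
    \<open>{d, d - 1}\<close> for \<open>d = min_gens T\<close>, and \<open>d\<close> is
    nonzero.\<close>
  have rank_two: "min_gens T = 1" if "n = 1"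
    using ranks_after_move_order_2 ranks_after_move_subset rank_T two that by auto
  consider "n = 0" | "n = 1" | "n \<ge> 2" "min_gens T = 1"
    | "n \<ge> 2" "min_gens T = 2" "?Klein" | "n \<ge> 2" "min_gens T = 2" "\<not> ?Klein"
    | "n \<ge> 2" "min_gens T \<ge> 3"
    using rank_T by linarith
  then show ?thesis
  proof cases
    case 1
    then have "GEN_nim (T \<times>\<times> H) = nim_by_rank (min_gens (T \<times>\<times> H)) False"
      using parity by (intro G.GEN_nim_odd_order) simp
    then show ?thesis using 1 n unfolding parity iffs by (simp add: nim_by_rank_def)
  next
    case 2
    then show ?thesis
      using GEN_nim_order_2 two rank_two unfolding parity iffs by simp
  next
    case 3
    \<comment> \<open>The Klein four-group has rank 2, so the branch for it does not apply.\<close>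
    then have "\<not> ?Klein" using ranks_after_move_Klein_four(2) by fastforce
    then show ?thesis using GEN_nim_cyclic two 3 unfolding parity iffs by auto
  next
    case 4
    then show ?thesis using GEN_nim_Klein_four unfolding parity iffs by simp
  next
    case 5
    then show ?thesis using GEN_nim_rank_2 unfolding parity iffs by simp
  next
    case 6
    then have "\<not> ?Klein" using ranks_after_move_Klein_four(2) by fastforce
    then show ?thesis using GEN_nim_rank_ge_3 6 unfolding parity iffs by auto
  qed
qed

end
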